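(* Let $\varphi$ be a degree-$3$ tropical rational map with slope sequence $(s_0,\dots,s_k)$. If the slope sequence is not palindromic (i.e. $(s_0,\dots,s_k)\neq(s_k,\dots,s_0)$), then $\mathrm{Aut}(\varphi)=\{1\}$.
   Context: The tropical projective line is $\mathbb{T}\mathbb{P}^1=\mathbb{R}\cup\{-\infty,+\infty\}$; its automorphism group $\mathrm{Aut}(\mathbb{T}\mathbb{P}^1)$ consists of the maps $x\mapsto\varepsilon x+b$, $\varepsilon\in\{\pm1\}$, $b\in\mathbb{R}$. A degree-$3$ tropical rational map is a continuous piecewise-linear function $\varphi:\mathbb{R}\to\mathbb{R}$ (extended to $\mathbb{T}\mathbb{P}^1\to\mathbb{T}\mathbb{P}^1$) with integer slopes and finitely many break points $x_1<\dots<x_k$ whose slope sequence $(s_0,\dots,s_k)$ ($s_i$ the slope on $(x_i,x_{i+1})$, $x_0=-\infty$, $x_{k+1}=+\infty$, consecutive slopes distinct) satisfies $s_0=s_k=3$ and $\sum_{i=1}^k|s_i-s_{i-1}|=4$. The automorphism group of $\varphi$ is $$\mathrm{Aut}(\varphi)=\{(\alpha,\beta)\in\mathrm{Aut}(\mathbb{T}\mathbb{P}^1)\times\mathrm{Aut}(\mathbb{T}\mathbb{P}^1) : \beta\circ\varphi=\varphi\circ\alpha\}.$$ *)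

theory Defs
  imports "HOL-Analysis.Analysis"
begin

text \<open>The tropical projective line is the type \<^typ>\<open>ereal\<close>.\<close>

definition aut_TP1 :: "(ereal \<Rightarrow> ereal) set" where
  "aut_TP1 = {\<alpha>. \<exists>\<epsilon> b :: real. \<epsilon> \<in> {1, -1} \<and> \<alpha> = (\<lambda>x. ereal \<epsilon> * x + ereal b)}"

text \<open>
  The real line minus the break points \<open>xs ! 0 < \<dots> < xs ! (k - 1)\<close>, where \<open>k = length xs\<close>, is the
  union of \<open>k + 1\<close> open intervals; the outer two are unbounded, so that the end points are
  taken in \<^typ>\<open>ereal\<close>.
\<close>

definition piece :: "real list \<Rightarrow> nat \<Rightarrow> real set" where
  "piece xs i = (let e = [-\<infinity>] @ map ereal xs @ [\<infinity>]
     in {t. e ! i < ereal t \<and> ereal t < e ! Suc i})"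

definition PL_map :: "(real \<Rightarrow> real) \<Rightarrow> real list \<Rightarrow> int list \<Rightarrow> bool" where
  "PL_map \<phi> xs ss \<longleftrightarrow>
     continuous_on UNIV \<phi> \<and>
     sorted_wrt (<) xs \<and>
     length ss = length xs + 1 \<and>
     (\<forall>i\<in>{1..length xs}. ss ! i \<noteq> ss ! (i - 1)) \<and>
     (\<forall>i\<le>length xs. \<exists>c. \<forall>t\<in>piece xs i. \<phi> t = of_int (ss ! i) * t + c)"

text \<open>
  The distinctness of consecutive slopes makes the break points and the slope sequence
  of a piecewise linear map unique.
\<close>

definition degree3_tropical_map :: "(real \<Rightarrow> real) \<Rightarrow> int list \<Rightarrow> bool" where
  "degree3_tropical_map \<phi> ss \<longleftrightarrow>
     (\<exists>xs. PL_map \<phi> xs ss \<and>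
           ss ! 0 = 3 \<and> ss ! length xs = 3 \<and>
           (\<Sum>i = 1..length xs. \<bar>ss ! i - ss ! (i - 1)\<bar>) = 4)"

definition extend_TP1 :: "(real \<Rightarrow> real) \<Rightarrow> ereal \<Rightarrow> ereal" where
  "extend_TP1 \<phi> x =
     (if x = \<infinity> then Lim at_top (\<lambda>t. ereal (\<phi> t))
      else if x = -\<infinity> then Lim at_bot (\<lambda>t. ereal (\<phi> t))
      else ereal (\<phi> (real_of_ereal x)))"

definition aut_map :: "(real \<Rightarrow> real) \<Rightarrow> ((ereal \<Rightarrow> ereal) \<times> (ereal \<Rightarrow> ereal)) set" where
  "aut_map \<phi> = {(\<alpha>, \<beta>) \<in> aut_TP1 \<times> aut_TP1. \<beta> \<circ> extend_TP1 \<phi> = extend_TP1 \<phi> \<circ> \<alpha>}"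

end

theory Submission
  imports Defs
begin

text \<open>
  The break points of a piecewise linear map \<open>\<phi>\<close> are exactly the points where \<open>\<phi>\<close> is not
  differentiable (lemma \<open>differentiable_iff_not_break_point\<close>). This description is invariant under
  affine changes of coordinates, so if \<open>\<beta> \<circ> \<phi> = \<phi> \<circ> \<alpha>\<close> with \<open>\<alpha> x = \<epsilon> x + b\<close> and
  \<open>\<beta> y = \<epsilon>' y + c\<close>, then \<open>\<alpha>\<close> permutes the finite set of break points
  (lemma \<open>affine_symmetry_permutes_break_points\<close>), and the chain rule compares the slope on a piece
  with the slope on its image (lemma \<open>affine_symmetry_slopes\<close>).

  For \<open>\<epsilon> = -1\<close> the map \<open>\<alpha>\<close> is a reflection; it reverses the list of break points and sends the
  \<open>i\<close>-th piece from the left to the \<open>i\<close>-th piece from the right. Slopes therefore satisfy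
  \<open>\<epsilon>' s\<^sub>i = - s\<^sub>k\<^sub>-\<^sub>i\<close>; as the two outer slopes agree and are not zero, \<open>\<epsilon>' = -1\<close> and the slope
  sequence is a palindrome. For \<open>\<epsilon> = 1\<close> the map \<open>\<alpha>\<close> is a translation, and a translation that
  preserves a nonempty finite set is trivial; there are break points because the total variation
  of the slopes is positive. Then \<open>\<alpha> = id\<close>, and since \<open>\<phi>\<close> is not constant on the
  leftmost piece, also \<open>\<beta> = id\<close>.
\<close>

section \<open>Pieces\<close>

text \<open>
  Avoiding the infinite end points in favour of a case distinction makes all later arguments
  about pieces take place in the reals.
\<close>
lemma piece_iff:
  assumes "i \<le> length xs"
  shows "t \<in> piece xs i \<longleftrightarrow>
    (i = 0 \<or> xs ! (i - 1) < t) \<and> (i = length xs \<or> t < xs ! i)"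
  using assms
  by (cases i) (auto simp: piece_def Let_def nth_append nth_Cons')

lemma open_piece: "open (piece xs i)"
proof -
  define e where "e = [-\<infinity>] @ map ereal xs @ [\<infinity>]"
  have "piece xs i = ereal -` {e ! i <..< e ! Suc i}"
    by (auto simp: piece_def e_def Let_def)
  then show ?thesis
    by (simp add: open_ereal_vimage)
qed

lemma piece_nonempty:
  assumes "sorted_wrt (<) xs" "i \<le> length xs"
  obtains t where "t \<in> piece xs i"
proof (cases "i = 0")
  case True
  then have "xs ! 0 - 1 \<in> piece xs i"
    by (simp add: piece_iff)
  then show ?thesis ..
next
  case i: False
  show ?thesis
  proof (cases "i = length xs")
    case True
    then have "xs ! (i - 1) + 1 \<in> piece xs i"
      by (simp add: piece_iff)
    then show ?thesis ..
  next
    case False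
    with i assms have "xs ! (i - 1) < xs ! i"
      by (auto intro: sorted_wrt_nth_less)
    then obtain t where "xs ! (i - 1) < t" "t < xs ! i"
      using dense by blast
    then show ?thesis
      using assms(2) that by (auto simp: piece_iff)
  qed
qed

lemma in_piece_if_not_break_point:
  assumes "t \<notin> set xs"
  obtains i where "i \<le> length xs" "t \<in> piece xs i"
proof -
  \<comment> \<open>The piece that contains \<open>t\<close> is the first whose right end point lies to the right of \<open>t\<close>.\<close>
  define P where "P = (\<lambda>i. i = length xs \<or> t < xs ! i)"
  define i where "i = (LEAST i. P i)"
  have P: "P i"
    unfolding i_def by (rule LeastI[of P "length xs"]) (simp add: P_def)
  have le: "i \<le> length xs"
    unfolding i_def by (rule Least_le) (simp add: P_def)
  have "xs ! (i - 1) < t" if "i \<noteq> 0"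
  proof -
    have "\<not> P (i - 1)"
      using that not_less_Least[of "i - 1" P] by (simp add: i_def)
    moreover have "xs ! (i - 1) \<noteq> t"
      using assms le that by (metis Suc_pred' less_eq_Suc_le nth_mem bot_nat_0.not_eq_extremum)
    ultimately show ?thesis
      by (simp add: P_def)
  qed
  then have "t \<in> piece xs i"
    using le P by (auto simp: piece_iff P_def)
  with le show ?thesis ..
qed

lemma eventually_at_left_piece:
  assumes "sorted_wrt (<) xs" "i < length xs"
  shows "eventually (\<lambda>t. t \<in> piece xs i) (at_left (xs ! i))"
proof (cases "i = 0")
  case True
  then show ?thesis
    using assms by (auto simp: piece_iff eventually_at_left_field intro!: exI[of _ "xs ! 0 - 1"])
next
  case False
  then have "xs ! (i - 1) < xs ! i"
    using assms by (auto intro: sorted_wrt_nth_less)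
  then show ?thesis
    using assms by (auto simp: piece_iff eventually_at_left_field intro!: exI[of _ "xs ! (i - 1)"])
qed

lemma eventually_at_right_piece:
  assumes "sorted_wrt (<) xs" "i < length xs"
  shows "eventually (\<lambda>t. t \<in> piece xs (Suc i)) (at_right (xs ! i))"
proof (cases "Suc i = length xs")
  case True
  then show ?thesis
    using assms
    by (auto simp: piece_iff eventually_at_right_field simp flip: True
        intro!: exI[of _ "xs ! i + 1"])
next
  case False
  then have "xs ! i < xs ! Suc i"
    using assms by (auto intro: sorted_wrt_nth_less)
  then show ?thesis
    using assms by (auto simp: piece_iff eventually_at_right_field intro!: exI[of _ "xs ! Suc i"])
qed

section \<open>Break points and differentiability\<close>

lemma PL_map_has_slope:
  assumes "PL_map \<phi> xs ss" "i \<le> length xs" "t \<in> piece xs i"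
  shows "(\<phi> has_field_derivative of_int (ss ! i)) (at t)"
proof -
  obtain c where c: "\<forall>t\<in>piece xs i. \<phi> t = of_int (ss ! i) * t + c"
    using assms(1,2) unfolding PL_map_def by blast
  have "((\<lambda>t. of_int (ss ! i) * t + c) has_field_derivative of_int (ss ! i)) (at t)"
    by (auto intro!: derivative_eq_intros)
  then show ?thesis
    by (rule has_field_derivative_transform_within_open[OF _ open_piece assms(3)]) (simp add: c)
qed

text \<open>
  A derivative at an end point of an affine stretch equals the slope of that stretch. Continuity
  at \<open>x\<close>, which differentiability provides, is what forces the affine formula to hold at \<open>x\<close> too.
\<close>
lemma derivative_eq_one_sided_slope:
  fixes f :: "real \<Rightarrow> real"
  assumes D: "(f has_field_derivative D) (at x)"
    and affine: "eventually (\<lambda>t. f t = s * t + c) (at x within S)"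
    and nontrivial: "at x within S \<noteq> bot"
  shows "D = s"
proof -
  have within: "(f has_field_derivative D) (at x within S)"
    using D by (rule has_field_derivative_at_within)
  have "(f \<longlongrightarrow> f x) (at x within S)"
    using within DERIV_continuous continuous_within by blast
  moreover have "(f \<longlongrightarrow> s * x + c) (at x within S)"
  proof (rule Lim_transform_eventually)
    show "((\<lambda>t. s * t + c) \<longlongrightarrow> s * x + c) (at x within S)"
      by (auto intro!: tendsto_eq_intros)
  qed (use affine in \<open>simp add: eq_commute\<close>)
  ultimately have fx: "f x = s * x + c"
    using nontrivial tendsto_unique by blast
  have "((\<lambda>t. (f t - f x) / (t - x)) \<longlongrightarrow> D) (at x within S)"
    using within by (simp add: has_field_derivative_iff)
  moreover have "eventually (\<lambda>t. t \<noteq> x) (at x within S)"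
    by (simp add: eventually_at_filter)
  with affine have "eventually (\<lambda>t. (f t - f x) / (t - x) = s) (at x within S)"
  proof eventually_elim
    case (elim t)
    then have "f t - f x = s * (t - x)" "t - x \<noteq> 0"
      by (simp_all add: fx algebra_simps)
    then show ?case
      by simp
  qed
  then have "((\<lambda>t. (f t - f x) / (t - x)) \<longlongrightarrow> s) (at x within S)"
    by (rule tendsto_eventually)
  ultimately show ?thesis
    using nontrivial tendsto_unique by blast
qed

text \<open>
  At a break point the slopes on the two sides differ, and a derivative would have to equal both.
\<close>
lemma differentiable_iff_not_break_point:
  assumes "PL_map \<phi> xs ss"
  shows "(\<exists>D. (\<phi> has_field_derivative D) (at x)) \<longleftrightarrow> x \<notin> set xs"
proof
  assume "\<exists>D. (\<phi> has_field_derivative D) (at x)"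
  then obtain D where D: "(\<phi> has_field_derivative D) (at x)" ..
  have sorted: "sorted_wrt (<) xs"
    using assms by (simp add: PL_map_def)
  show "x \<notin> set xs"
  proof
    assume "x \<in> set xs"
    then obtain i where i: "i < length xs" "x = xs ! i"
      by (auto simp: in_set_conv_nth)
    obtain c where c: "\<forall>t\<in>piece xs i. \<phi> t = of_int (ss ! i) * t + c"
      using assms less_imp_le[OF i(1)] unfolding PL_map_def by blast
    obtain d where d: "\<forall>t\<in>piece xs (Suc i). \<phi> t = of_int (ss ! Suc i) * t + d"
      using assms Suc_leI[OF i(1)] unfolding PL_map_def by blast
    have "D = of_int (ss ! i)"
      using D
    proof (rule derivative_eq_one_sided_slope)
      show "eventually (\<lambda>t. \<phi> t = of_int (ss ! i) * t + c) (at_left x)"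
        using eventually_at_left_piece[OF sorted i(1)] unfolding i(2)
        by eventually_elim (use c in blast)
    qed simp
    moreover have "D = of_int (ss ! Suc i)"
      using D
    proof (rule derivative_eq_one_sided_slope)
      show "eventually (\<lambda>t. \<phi> t = of_int (ss ! Suc i) * t + d) (at_right x)"
        using eventually_at_right_piece[OF sorted i(1)] unfolding i(2)
        by eventually_elim (use d in blast)
    qed simp
    moreover have "ss ! Suc i \<noteq> ss ! (Suc i - 1)"
      using assms i(1) unfolding PL_map_def by (metis Suc_leI atLeastAtMost_iff le_add1 plus_1_eq_Suc)
    ultimately show False
      by simp
  qed
next
  assume "x \<notin> set xs"
  then show "\<exists>D. (\<phi> has_field_derivative D) (at x)"
    using in_piece_if_not_break_point PL_map_has_slope[OF assms] by metis
qed

section \<open>Affine symmetries\<close>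

text \<open>
  The chain rule, solved for \<open>\<phi>\<close>: since \<open>\<epsilon>' \<noteq> 0\<close>, differentiability of \<open>\<phi>\<close> at the image point
  yields differentiability at the original point.
\<close>
lemma affine_symmetry_derivative:
  fixes \<phi> :: "real \<Rightarrow> real"
  assumes sym: "(\<lambda>y. \<epsilon>' * y + c) \<circ> \<phi> = \<phi> \<circ> (\<lambda>x. \<epsilon> * x + b)" and "\<epsilon>' \<noteq> 0"
    and D: "(\<phi> has_field_derivative D) (at (\<epsilon> * x + b))"
  shows "(\<phi> has_field_derivative \<epsilon> * D / \<epsilon>') (at x)"
proof -
  have "((\<lambda>x. \<epsilon> * x + b) has_field_derivative \<epsilon>) (at x)"
    by (auto intro!: derivative_eq_intros)
  from DERIV_chain2[OF D this]
  have "((\<lambda>x. (\<phi> (\<epsilon> * x + b) - c) / \<epsilon>') has_field_derivative \<epsilon> * D / \<epsilon>') (at x)"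
    using \<open>\<epsilon>' \<noteq> 0\<close> by (auto intro!: derivative_eq_intros simp: mult.commute)
  moreover have "\<phi> (\<epsilon> * x + b) = \<epsilon>' * \<phi> x + c" for x
    using fun_cong[OF sym, of x] by simp
  then have "(\<lambda>x. (\<phi> (\<epsilon> * x + b) - c) / \<epsilon>') = \<phi>"
    using \<open>\<epsilon>' \<noteq> 0\<close> by simp
  ultimately show ?thesis
    by simp
qed

text \<open>
  An injective self-map of a finite set is onto, so it suffices that break points go to break points.
\<close>
lemma affine_symmetry_permutes_break_points:
  assumes "PL_map \<phi> xs ss" "(\<lambda>y. \<epsilon>' * y + c) \<circ> \<phi> = \<phi> \<circ> (\<lambda>x. \<epsilon> * x + b)" "\<epsilon>' \<noteq> 0" "\<epsilon> \<noteq> 0"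
  shows "(\<lambda>x. \<epsilon> * x + b) ` set xs = set xs"
proof (rule endo_inj_surj)
  show "(\<lambda>x. \<epsilon> * x + b) ` set xs \<subseteq> set xs"
  proof safe
    fix x assume "x \<in> set xs"
    then have "\<nexists>D. (\<phi> has_field_derivative D) (at x)"
      by (simp add: differentiable_iff_not_break_point[OF assms(1)])
    then have "\<nexists>D. (\<phi> has_field_derivative D) (at (\<epsilon> * x + b))"
      using affine_symmetry_derivative[OF assms(2,3), where x = x] by metis
    then show "\<epsilon> * x + b \<in> set xs"
      by (simp add: differentiable_iff_not_break_point[OF assms(1)])
  qed
  show "inj_on (\<lambda>x. \<epsilon> * x + b) (set xs)"
    using \<open>\<epsilon> \<noteq> 0\<close> by (auto simp: inj_on_def)
qed simp

lemma affine_symmetry_slopes: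
  assumes "PL_map \<phi> xs ss" "(\<lambda>y. \<epsilon>' * y + c) \<circ> \<phi> = \<phi> \<circ> (\<lambda>x. \<epsilon> * x + b)" "\<epsilon>' \<noteq> 0"
    and "i \<le> length xs" "t \<in> piece xs i" "j \<le> length xs" "\<epsilon> * t + b \<in> piece xs j"
  shows "\<epsilon>' * of_int (ss ! i) = \<epsilon> * of_int (ss ! j)"
proof -
  have "(\<phi> has_field_derivative \<epsilon> * of_int (ss ! j) / \<epsilon>') (at t)"
    using affine_symmetry_derivative[OF assms(2,3)] PL_map_has_slope[OF assms(1,6,7)] .
  then have "of_int (ss ! i) = \<epsilon> * of_int (ss ! j) / \<epsilon>'"
    by (rule DERIV_unique[OF PL_map_has_slope[OF assms(1,4,5)]])
  with \<open>\<epsilon>' \<noteq> 0\<close> show ?thesis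
    by (simp add: field_simps)
qed

section \<open>Translations and reflections\<close>

text \<open>A translation by \<open>b\<close> changes the sum of the elements by \<open>b\<close> times their number.\<close>
lemma translation_of_finite_set_trivial:
  fixes b :: real
  assumes "finite A" "A \<noteq> {}" "(\<lambda>x. x + b) ` A = A"
  shows "b = 0"
proof -
  have "sum id A = (\<Sum>x\<in>A. x + b)"
    using sum.reindex[of "\<lambda>x. x + b" A id] assms(3) by (simp add: inj_on_def o_def)
  then show ?thesis
    using assms(1,2) by (simp add: sum.distrib)
qed

lemma reflection_reverses_sorted_list:
  fixes xs :: "real list"
  assumes "sorted_wrt (<) xs" "(\<lambda>x. b - x) ` set xs = set xs"
  shows "rev (map (\<lambda>x. b - x) xs) = xs"
proof (rule strict_sorted_equal)
  show "sorted_wrt (<) (rev (map (\<lambda>x. b - x) xs))"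
    using assms(1) by (simp add: sorted_wrt_rev sorted_wrt_map)
qed (use assms in auto)

lemma reflection_reverses_pieces:
  assumes "rev (map (\<lambda>x. b - x) xs) = xs" "i \<le> length xs" "t \<in> piece xs i"
  shows "b - t \<in> piece xs (length xs - i)"
proof -
  have nth: "xs ! j = b - xs ! (length xs - Suc j)" if "j < length xs" for j
  proof -
    have "xs ! j = rev (map (\<lambda>x. b - x) xs) ! j"
      by (simp add: assms(1))
    then show ?thesis
      using that by (simp add: rev_nth)
  qed
  have "xs ! (length xs - i - 1) < b - t" if "i < length xs"
    using nth[of i] that assms(3) by (simp add: piece_iff)
  moreover have "b - t < xs ! (length xs - i)" if "i \<noteq> 0"
    using nth[of "length xs - i"] that assms(2,3) by (simp add: piece_iff)
  moreover have "length xs - i = 0 \<longleftrightarrow> \<not> i < length xs" "length xs - i = length xs \<longleftrightarrow> i = 0"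
    using assms(2) by auto
  ultimately show ?thesis
    by (simp only: piece_iff diff_le_self) blast
qed

text \<open>
  The equation for the outermost pieces has the same slope on both sides, which determines the sign
  \<open>\<epsilon>'\<close>; the equations for the other pieces then say that the slope sequence is a palindrome.
\<close>
lemma palindrome_if_reflection_symmetry:
  assumes PL: "PL_map \<phi> xs ss" and sym: "(\<lambda>y. \<epsilon>' * y + c) \<circ> \<phi> = \<phi> \<circ> (\<lambda>x. - 1 * x + b)" and "\<epsilon>' \<noteq> 0"
    and outer: "ss ! length xs = ss ! 0" "ss ! 0 \<noteq> 0"
  shows "ss = rev ss"
proof -
  have sorted: "sorted_wrt (<) xs" and len: "length ss = length xs + 1"
    using PL by (auto simp: PL_map_def)
  have "(\<lambda>x. b - x) ` set xs = set xs"
    using affine_symmetry_permutes_break_points[OF PL sym \<open>\<epsilon>' \<noteq> 0\<close>] by simp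
  then have refl: "rev (map (\<lambda>x. b - x) xs) = xs"
    using sorted by (rule reflection_reverses_sorted_list[rotated])
  have slopes: "\<epsilon>' * of_int (ss ! i) = - of_int (ss ! (length xs - i))" if i: "i \<le> length xs" for i
  proof -
    obtain t where t: "t \<in> piece xs i"
      using piece_nonempty[OF sorted i] .
    have "- 1 * t + b \<in> piece xs (length xs - i)"
      using reflection_reverses_pieces[OF refl i t] by simp
    from affine_symmetry_slopes[OF PL sym \<open>\<epsilon>' \<noteq> 0\<close> i t _ this] show ?thesis
      by simp
  qed
  have "(\<epsilon>' + 1) * of_int (ss ! 0) = 0"
    using slopes[of 0] outer(1) by (simp add: algebra_simps)
  then have "\<epsilon>' = -1"
    using outer(2) by (simp add: add_eq_0_iff2)
  then have eq: "ss ! i = ss ! (length xs - i)" if "i \<le> length xs" for i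
    using slopes[OF that] by simp
  show ?thesis
  proof (rule nth_equalityI)
    fix i assume "i < length ss"
    with len have i: "i \<le> length xs" "rev ss ! i = ss ! (length xs - i)"
      by (simp_all add: rev_nth)
    show "ss ! i = rev ss ! i"
      using eq[OF i(1)] by (simp only: i(2))
  qed simp
qed

text \<open>
  Break points leave no room for a nonzero translation on the source side. Once \<open>b = 0\<close>, any piece
  with a nonzero slope determines the sign on the target side; the leftmost one is used here.
\<close>
lemma translation_symmetry_trivial:
  assumes PL: "PL_map \<phi> xs ss" and sym: "(\<lambda>y. \<epsilon>' * y + c) \<circ> \<phi> = \<phi> \<circ> (\<lambda>x. 1 * x + b)" and "\<epsilon>' \<noteq> 0"
    and "xs \<noteq> []" "ss ! 0 \<noteq> 0"
  shows "\<epsilon>' = 1" "b = 0" "c = 0"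
proof -
  show b: "b = 0"
    using affine_symmetry_permutes_break_points[OF PL sym \<open>\<epsilon>' \<noteq> 0\<close>] \<open>xs \<noteq> []\<close>
    by (intro translation_of_finite_set_trivial[of "set xs"]) auto
  obtain t where t: "t \<in> piece xs 0"
    using PL piece_nonempty[of xs 0] by (auto simp: PL_map_def)
  have "\<epsilon>' * of_int (ss ! 0) = 1 * of_int (ss ! 0)"
    using affine_symmetry_slopes[OF PL sym \<open>\<epsilon>' \<noteq> 0\<close> _ t, of 0] t b by simp
  with \<open>ss ! 0 \<noteq> 0\<close> show "\<epsilon>' = 1"
    by simp
  with b fun_cong[OF sym, of 0] show "c = 0"
    by simp
qed

lemma id_in_aut_TP1: "id \<in> aut_TP1"
proof -
  have "id = (\<lambda>x. ereal 1 * x + ereal 0)"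
    by (simp add: fun_eq_iff flip: one_ereal_def zero_ereal_def)
  then show ?thesis
    unfolding aut_TP1_def by blast
qed

theorem proposition5:
  fixes \<phi> :: "real \<Rightarrow> real" and ss :: "int list"
  assumes "degree3_tropical_map \<phi> ss"
    and "ss \<noteq> rev ss"
  shows "aut_map \<phi> = {(id, id)}"
proof -
  obtain xs where PL: "PL_map \<phi> xs ss" and outer: "ss ! 0 = 3" "ss ! length xs = 3"
    and degree: "(\<Sum>i = 1..length xs. \<bar>ss ! i - ss ! (i - 1)\<bar>) = 4"
    using assms(1) by (auto simp: degree3_tropical_map_def)
  have xs: "xs \<noteq> []"
    using degree by auto
  have "(\<alpha>, \<beta>) = (id, id)" if "(\<alpha>, \<beta>) \<in> aut_map \<phi>" for \<alpha> \<beta>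
  proof -
    have "\<alpha> \<in> aut_TP1" "\<beta> \<in> aut_TP1"
      using that by (simp_all add: aut_map_def)
    obtain \<epsilon> b where \<epsilon>: "\<epsilon> \<in> {1, -1}" and \<alpha>: "\<alpha> = (\<lambda>x. ereal \<epsilon> * x + ereal b)"
      using \<open>\<alpha> \<in> aut_TP1\<close> unfolding aut_TP1_def by blast
    obtain \<epsilon>' c where \<epsilon>': "\<epsilon>' \<in> {1, -1}" and \<beta>: "\<beta> = (\<lambda>x. ereal \<epsilon>' * x + ereal c)"
      using \<open>\<beta> \<in> aut_TP1\<close> unfolding aut_TP1_def by blast
    have sym: "(\<lambda>y. \<epsilon>' * y + c) \<circ> \<phi> = \<phi> \<circ> (\<lambda>x. \<epsilon> * x + b)"
    proof
      fix x
      have "\<beta> (extend_TP1 \<phi> (ereal x)) = extend_TP1 \<phi> (\<alpha> (ereal x))"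
        using that by (simp add: aut_map_def fun_eq_iff)
      then show "((\<lambda>y. \<epsilon>' * y + c) \<circ> \<phi>) x = (\<phi> \<circ> (\<lambda>x. \<epsilon> * x + b)) x"
        by (simp add: \<alpha> \<beta> extend_TP1_def)
    qed
    have "\<epsilon>' \<noteq> 0"
      using \<epsilon>' by auto
    have "\<epsilon> \<noteq> -1"
    proof
      assume "\<epsilon> = -1"
      from palindrome_if_reflection_symmetry[OF PL sym[unfolded this] \<open>\<epsilon>' \<noteq> 0\<close>]
      show False
        using outer assms(2) by simp
    qed
    with \<epsilon> have "\<epsilon> = 1"
      by simp
    have "\<epsilon>' = 1" "b = 0" "c = 0"
      using translation_symmetry_trivial[OF PL sym[unfolded \<open>\<epsilon> = 1\<close>] \<open>\<epsilon>' \<noteq> 0\<close> xs] outer by auto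
    with \<open>\<epsilon> = 1\<close> show ?thesis
      by (auto simp: \<alpha> \<beta> fun_eq_iff simp flip: one_ereal_def zero_ereal_def)
  qed
  moreover have "(id, id) \<in> aut_map \<phi>"
    by (simp add: aut_map_def id_in_aut_TP1)
  ultimately show ?thesis
    by auto
qed

end
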